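(* Let $R$ be a ring and consider the following conditions. (1) Every proper ideal of $R$ is weakly $1$-absorbing prime. (2) $R$ is a local ring with a unique maximal ideal $M$ such that $M^3=0$. (3) $R=R_1\times R_2$, where $R_1$ is a local ring with a unique maximal ideal $M_1$ such that $M_1^2=0$ and $R_2$ is a field. (4) $R=R_1\times R_2\times R_3$, where $R_1,R_2,R_3$ are fields. If (1) holds, then (2) or (3) or (4) holds. Furthermore, $(2)\Rightarrow(1)$ holds, but the implications $(3)\Rightarrow(1)$ and $(4)\Rightarrow(1)$ are not true in general (that is, there is a ring satisfying (3) but not (1), and there is a ring satisfying (4) but not (1)).
   Context: All rings are commutative with identity. A ring is called local if it has a unique maximal ideal. A proper ideal $I$ of a ring $R$ (i.e. $I\neq R$) is called weakly $1$-absorbing prime if for all nonunit elements $a,b,c\in R$ with $0\neq abc\in I$, either $ab\in I$ or $c\in I$. Equalities of $R$ with a direct product of rings are understood up to ring isomorphism. *)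

theory Defs
  imports
    "HOL-Algebra.Ideal_Product"
    "HOL-Algebra.QuotRing"
    "HOL-Algebra.Chinese_Remainder"
begin

definition weakly_1_absorbing_prime :: "'a set \<Rightarrow> ('a, 'b) ring_scheme \<Rightarrow> bool" where
  "weakly_1_absorbing_prime I R \<longleftrightarrow>
     ideal I R \<and> I \<noteq> carrier R \<and>
     (\<forall>a \<in> carrier R - Units R. \<forall>b \<in> carrier R - Units R. \<forall>c \<in> carrier R - Units R.
        a \<otimes>\<^bsub>R\<^esub> b \<otimes>\<^bsub>R\<^esub> c \<noteq> \<zero>\<^bsub>R\<^esub> \<and> a \<otimes>\<^bsub>R\<^esub> b \<otimes>\<^bsub>R\<^esub> c \<in> I \<longrightarrow>
        a \<otimes>\<^bsub>R\<^esub> b \<in> I \<or> c \<in> I)"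

definition local_ring_with_max :: "('a, 'b) ring_scheme \<Rightarrow> 'a set \<Rightarrow> bool" where
  "local_ring_with_max R M \<longleftrightarrow>
     cring R \<and> maximalideal M R \<and> (\<forall>N. maximalideal N R \<longrightarrow> N = M)"

definition every_proper_ideal_w1ap :: "('a, 'b) ring_scheme \<Rightarrow> bool" where
  "every_proper_ideal_w1ap R \<longleftrightarrow>
     (\<forall>I. ideal I R \<and> I \<noteq> carrier R \<longrightarrow> weakly_1_absorbing_prime I R)"

definition local_cube_zero :: "('a, 'b) ring_scheme \<Rightarrow> bool" where
  "local_cube_zero R \<longleftrightarrow>
     (\<exists>M. local_ring_with_max R M \<and>
        ideal_prod R (ideal_prod R M M) M = {\<zero>\<^bsub>R\<^esub>})"

text \<open>
  In the next two definitions the factors live on the carrier type of \<open>R\<close> itself. This is no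
  restriction: if \<open>R\<close> is isomorphic to a product of rings, each factor is isomorphic to an ideal
  of \<open>R\<close>, regarded as a ring with its own identity element.
\<close>

definition local_square_zero_times_field :: "('a, 'b) ring_scheme \<Rightarrow> bool" where
  "local_square_zero_times_field R \<longleftrightarrow>
     (\<exists>(R1 :: 'a ring) (R2 :: 'a ring) M1.
        local_ring_with_max R1 M1 \<and> ideal_prod R1 M1 M1 = {\<zero>\<^bsub>R1\<^esub>} \<and>
        field R2 \<and>
        R \<simeq> RDirProd R1 R2)"

definition product_of_three_fields :: "('a, 'b) ring_scheme \<Rightarrow> bool" where
  "product_of_three_fields R \<longleftrightarrow>
     (\<exists>(R1 :: 'a ring) (R2 :: 'a ring) (R3 :: 'a ring).
        field R1 \<and> field R2 \<and> field R3 \<and>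
        R \<simeq> RDirProd R1 (RDirProd R2 R3))"

end

theory Submission
  imports Defs "HOL-Number_Theory.Residues"
begin

text \<open>
  Applying (1) to the principal ideal \<open>(abc)\<close> shows that nonunits with \<open>abc \<noteq> 0\<close> satisfy
  \<open>ab \<in> (abc)\<close> or \<open>c \<in> (abc)\<close>. If the nonunits form an ideal \<open>M\<close>, then \<open>1 - m\<close> is a unit for
  \<open>m \<in> M\<close>, so either alternative forces \<open>abc = 0\<close>, that is \<open>M\<^sup>3 = 0\<close>. Otherwise there is a nonunit
  \<open>x\<close> for which \<open>y = 1 - x\<close> is a nonunit too. As \<open>x\<close> and \<open>y\<close> are comaximal, both alternatives for
  \<open>x, x, y\<close> are impossible, whence \<open>x\<^sup>2y = 0 = xy\<^sup>2\<close>, so \<open>xy = xy(x + y) = 0\<close> and \<open>x\<close> is idempotent;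
  the dichotomy applied once more makes \<open>Rx\<close> and \<open>Ry\<close> fields. Thus (1) actually implies (2) or a
  product of two fields, and (4) never occurs. Conversely (2) makes (1) hold vacuously. The
  counterexamples are \<open>\<int>/12 = \<int>/4 \<times> \<int>/3\<close> and \<open>\<int>/30 = \<int>/2 \<times> \<int>/3 \<times> \<int>/5\<close>.
\<close>

text \<open>For an idempotent \<open>e\<close> this is the ring \<open>eR\<close>: there
  \<open>e x = x\<close> holds exactly for the multiples of \<open>e\<close>. The carrier type stays
  that of \<open>R\<close>, as the product decompositions require of their factors.\<close>

definition corner_ring :: "('a, 'b) ring_scheme \<Rightarrow> 'a \<Rightarrow> 'a ring" where
  "corner_ring R e =
     \<lparr>carrier = {x \<in> carrier R. e \<otimes>\<^bsub>R\<^esub> x = x}, monoid.mult = (\<otimes>\<^bsub>R\<^esub>), one = e,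
      zero = \<zero>\<^bsub>R\<^esub>, add = (\<oplus>\<^bsub>R\<^esub>)\<rparr>"

section \<open>Units, the ideal of nonunits, and products of ideals\<close>

context cring
begin

lemma unit_mult_factor:
  assumes "a \<in> carrier R" "b \<in> carrier R" "a \<otimes> b \<in> Units R"
  shows "a \<in> Units R"
proof -
  have "a \<otimes> (b \<otimes> inv (a \<otimes> b)) = \<one>"
    using assms Units_r_inv[OF assms(3)] by (simp flip: m_assoc)
  moreover have "b \<otimes> inv (a \<otimes> b) \<in> carrier R"
    using assms by simp
  ultimately show ?thesis
    unfolding Units_def using assms(1) m_comm[OF assms(1)] by auto
qed

lemma unit_if_mult_eq_one:
  assumes "a \<in> carrier R" "b \<in> carrier R" "a \<otimes> b = \<one>"
  shows "a \<in> Units R"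
  using unit_mult_factor[OF assms(1,2)] assms(3) by simp

lemma proper_ideal_unit_free:
  assumes "ideal I R" "I \<noteq> carrier R" "x \<in> I"
  shows "x \<notin> Units R"
proof
  interpret I: ideal I R by fact
  assume "x \<in> Units R"
  then have "\<one> \<in> I"
    using I.I_r_closed[OF assms(3), of "inv x"] by simp
  then show False
    using assms(2) I.one_imp_carrier by blast
qed

text \<open>Closure under addition comes from \<open>compl\<close>: if \<open>a + b\<close> had an
  inverse \<open>v\<close>, the nonunits \<open>av\<close> and \<open>bv\<close> would add up to 1.
  Maximality and uniqueness follow because a proper ideal consists of nonunits.\<close>

lemma local_ring_with_max_nonunits:
  assumes "\<one> \<noteq> \<zero>"
    and compl: "\<And>x. x \<in> carrier R - Units R \<Longrightarrow> \<one> \<ominus> x \<in> Units R"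
  shows "local_ring_with_max R (carrier R - Units R)"
proof -
  let ?M = "carrier R - Units R"
  have mult: "x \<otimes> a \<in> ?M" "a \<otimes> x \<in> ?M" if "a \<in> ?M" "x \<in> carrier R" for a x
    using that unit_mult_factor[of a x] m_comm[of a x] by auto
  have zero: "\<zero> \<in> ?M"
    using assms(1) by (metis DiffI Units_r_inv_ex l_null zero_closed)
  have add: "a \<oplus> b \<in> ?M" if a: "a \<in> ?M" and b: "b \<in> ?M" for a b
  proof (rule ccontr)
    assume "a \<oplus> b \<notin> ?M"
    then have u: "a \<oplus> b \<in> Units R" using a b by simp
    define v where "v = inv (a \<oplus> b)"
    have v: "v \<in> carrier R" "(a \<oplus> b) \<otimes> v = \<one>"
      using u by (auto simp: v_def)
    have "\<one> \<ominus> a \<otimes> v = b \<otimes> v"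
      using a b v(1) unfolding v(2)[symmetric] by simp algebra
    moreover have "\<one> \<ominus> a \<otimes> v \<in> Units R"
      using compl mult(2)[OF a v(1)] .
    ultimately show False
      using mult(2)[OF b v(1)] by auto
  qed
  have ideal: "ideal ?M R"
  proof (rule idealI)
    show "subgroup ?M (add_monoid R)"
    proof
      fix x assume x: "x \<in> ?M"
      have "inv\<^bsub>add_monoid R\<^esub> x = \<ominus> \<one> \<otimes> x"
        using x by (simp add: a_inv_def[symmetric] l_minus)
      then show "inv\<^bsub>add_monoid R\<^esub> x \<in> ?M"
        using mult(1)[OF x, of "\<ominus> \<one>"] by simp
    qed (use add zero in auto)
  qed (use mult ring_axioms in auto)
  have max: "N = ?M" if "ideal N R" "N \<noteq> carrier R" "?M \<subseteq> N" for N
  proof -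
    interpret N: ideal N R by fact
    show ?thesis
      using that proper_ideal_unit_free[OF that(1,2)] N.a_subset by blast
  qed
  have "maximalideal ?M R"
    using max by (intro maximalidealI[OF ideal]) auto
  moreover have "N = ?M" if N: "maximalideal N R" for N
  proof -
    interpret N: maximalideal N R by fact
    have "N \<subseteq> ?M"
      using proper_ideal_unit_free[OF N.ideal_axioms] N.I_notcarr N.a_subset by blast
    then show ?thesis
      using N.I_maximal[OF ideal] by auto
  qed
  ultimately show ?thesis
    unfolding local_ring_with_max_def using cring_axioms by blast
qed

lemma ideal_prod_eq_zero:
  assumes "ideal I R" "ideal J R" "\<And>x y. x \<in> I \<Longrightarrow> y \<in> J \<Longrightarrow> x \<otimes> y = \<zero>"
  shows "ideal_prod R I J = {\<zero>}"
proof -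
  have "x = \<zero>" if "x \<in> ideal_prod R I J" for x
    using that by induction (auto simp: assms(3))
  moreover have "\<zero> \<in> ideal_prod R I J"
    using ideal_prod_is_ideal[OF assms(1,2)]
    by (simp add: ideal_def additive_subgroup.zero_closed)
  ultimately show ?thesis by blast
qed

text \<open>Elements of \<open>ideal_prod R I I\<close> are built from products by addition, so
  vanishing of triple products spreads by induction and distributivity.\<close>

lemma ideal_triple_prod_eq_zero:
  assumes "ideal I R" "\<And>x y z. x \<in> I \<Longrightarrow> y \<in> I \<Longrightarrow> z \<in> I \<Longrightarrow> x \<otimes> y \<otimes> z = \<zero>"
  shows "ideal_prod R (ideal_prod R I I) I = {\<zero>}"
proof (rule ideal_prod_eq_zero)
  show "ideal (ideal_prod R I I) R" "ideal I R"
    using assms ideal_prod_is_ideal by auto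
  have I: "I \<subseteq> carrier R"
    using assms(1) by (simp add: ideal_def additive_subgroup.a_subset)
  have car: "ideal_prod R I I \<subseteq> carrier R"
    by (simp add: assms(1) ideal_prod_in_carrier)
  fix x y assume "x \<in> ideal_prod R I I" and y: "y \<in> I"
  then show "x \<otimes> y = \<zero>"
  proof induction
    case (sum s t)
    then show ?case using car I y by (auto simp: l_distr subset_iff)
  qed (use assms(2) in auto)
qed

section \<open>Divisibility from condition (1), and the local case in both directions\<close>

lemma w1ap_nonunits_dichotomy:
  assumes "every_proper_ideal_w1ap R"
    and a: "a \<in> carrier R - Units R" and b: "b \<in> carrier R - Units R"
    and c: "c \<in> carrier R - Units R" and nz: "a \<otimes> b \<otimes> c \<noteq> \<zero>"
  shows "(\<exists>r \<in> carrier R. a \<otimes> b = r \<otimes> (a \<otimes> b \<otimes> c)) \<or> (\<exists>r \<in> carrier R. c = r \<otimes> (a \<otimes> b \<otimes> c))"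
proof -
  let ?p = "a \<otimes> b \<otimes> c"
  have p: "?p \<in> carrier R" using a b c by simp
  \<comment> \<open>A factor of a unit is a unit, so abc is a nonunit along with a; its principal
    ideal is therefore proper and (1) applies to it.\<close>
  have nu: "?p \<notin> Units R"
    using unit_mult_factor[of a "b \<otimes> c"] a b c by (auto simp: m_assoc)
  have "\<one> \<notin> PIdl ?p"
  proof
    assume "\<one> \<in> PIdl ?p"
    then obtain r where "r \<in> carrier R" "\<one> = r \<otimes> ?p"
      by (auto simp: cgenideal_def)
    then have "?p \<in> Units R"
      using unit_if_mult_eq_one[OF p, of r] m_comm[OF p, of r] by simp
    then show False using nu by simp
  qed
  then have "weakly_1_absorbing_prime (PIdl ?p) R"
    using assms(1) cgenideal_ideal[OF p] unfolding every_proper_ideal_w1ap_def by auto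
  then have "a \<otimes> b \<in> PIdl ?p \<or> c \<in> PIdl ?p"
    using a b c nz cgenideal_self[OF p] unfolding weakly_1_absorbing_prime_def by blast
  then show ?thesis
    by (auto simp: cgenideal_def)
qed

text \<open>A one-element Nakayama argument: \<open>(1 - y) x = 0\<close>, and the unit
  \<open>1 - y\<close> cancels.\<close>

lemma zero_if_fixed:
  assumes "x \<in> carrier R" "y \<in> carrier R" "x = y \<otimes> x" "\<one> \<ominus> y \<in> Units R"
  shows "x = \<zero>"
proof -
  have "(\<one> \<ominus> y) \<otimes> x = x \<ominus> y \<otimes> x"
    using assms(1,2) by algebra
  also have "\<dots> = \<zero>"
    using assms(1) unfolding assms(3)[symmetric] by (simp add: r_neg minus_eq)
  finally have "(\<one> \<ominus> y) \<otimes> x = (\<one> \<ominus> y) \<otimes> \<zero>"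
    using assms(2) by simp
  then show ?thesis
    using Units_l_cancel[OF assms(4,1) zero_closed] by simp
qed

text \<open>Each alternative of the dichotomy is a fixed-point equation,
  \<open>ab = (rc)(ab)\<close> or \<open>c = (rab)c\<close>. The multiplier is a nonunit, so
  \<open>zero_if_fixed\<close> makes ab or c vanish, against abc \<noteq> 0.\<close>

lemma local_cube_zero_if_w1ap:
  assumes one: "\<one> \<noteq> \<zero>" and w: "every_proper_ideal_w1ap R"
    and compl: "\<And>x. x \<in> carrier R - Units R \<Longrightarrow> \<one> \<ominus> x \<in> Units R"
  shows "local_cube_zero R"
proof -
  let ?M = "carrier R - Units R"
  have loc: "local_ring_with_max R ?M"
    using local_ring_with_max_nonunits[OF one compl] .
  then have "ideal ?M R"
    by (auto simp: local_ring_with_max_def maximalideal_def)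
  have "a \<otimes> b \<otimes> c = \<zero>" if a: "a \<in> ?M" and b: "b \<in> ?M" and c: "c \<in> ?M" for a b c
  proof (rule ccontr)
    assume nz: "a \<otimes> b \<otimes> c \<noteq> \<zero>"
    have nonunit: "s \<otimes> x \<in> ?M" if "x \<in> ?M" "s \<in> carrier R" for s x
      using that unit_mult_factor[of x s] m_comm[of x s] by auto
    from w1ap_nonunits_dichotomy[OF w a b c nz] show False
    proof (elim disjE bexE)
      fix r assume r: "r \<in> carrier R" "a \<otimes> b = r \<otimes> (a \<otimes> b \<otimes> c)"
      have "a \<otimes> b = (r \<otimes> c) \<otimes> (a \<otimes> b)"
        using a b c r(1) by (subst r(2)) (simp add: m_ac)
      then have "a \<otimes> b = \<zero>"
        using zero_if_fixed[of "a \<otimes> b" "r \<otimes> c"] a b c r(1) compl[OF nonunit[OF c r(1)]] by simp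
      then show False using nz c by simp
    next
      fix r assume r: "r \<in> carrier R" "c = r \<otimes> (a \<otimes> b \<otimes> c)"
      have "c = (r \<otimes> a \<otimes> b) \<otimes> c"
        using a b c r(1) by (subst r(2)) (simp add: m_ac)
      moreover have "\<one> \<ominus> r \<otimes> a \<otimes> b \<in> Units R"
        using compl[OF nonunit[OF b, of "r \<otimes> a"]] a r(1) by simp
      ultimately have "c = \<zero>"
        using zero_if_fixed[of c "r \<otimes> a \<otimes> b"] a b c r(1) by simp
      then show False using nz a b by simp
    qed
  qed
  then show ?thesis
    unfolding local_cube_zero_def
    using loc ideal_triple_prod_eq_zero[OF \<open>ideal ?M R\<close>] by blast
qed

text \<open>A nonunit outside \<open>M\<close> would be invertible modulo \<open>M\<close>, and \<open>1 - m\<close> has inverse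
  \<open>1 + m + m\<^sup>2\<close> since \<open>m\<^sup>3 = 0\<close>; so no choice principle is needed to see that nonunits lie in \<open>M\<close>.\<close>
lemma w1ap_if_local_cube_zero:
  assumes "local_cube_zero R"
  shows "every_proper_ideal_w1ap R"
proof -
  obtain M where M: "maximalideal M R"
    and cube: "ideal_prod R (ideal_prod R M M) M = {\<zero>}"
    using assms by (auto simp: local_cube_zero_def local_ring_with_max_def)
  interpret M: maximalideal M R by fact
  have zero: "x \<otimes> y \<otimes> z = \<zero>" if "x \<in> M" "y \<in> M" "z \<in> M" for x y z
    using cube ideal_prod.prod[OF ideal_prod.prod[OF that(1,2)] that(3)] by auto
  have inM: "x \<in> M" if x: "x \<in> carrier R - Units R" for x
  proof (rule ccontr)
    assume "x \<notin> M"
    have xc: "x \<in> carrier R" using x by simp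
    have PI: "ideal (PIdl x) R" using cgenideal_ideal[OF xc] .
    \<comment> \<open>This ideal is strictly larger than M, so by maximality it contains 1, which
      yields an inverse of x modulo M.\<close>
    have "ideal (M <+>\<^bsub>R\<^esub> PIdl x) R"
      using add_ideals[OF M.ideal_axioms PI] .
    moreover have "M \<subseteq> M <+>\<^bsub>R\<^esub> PIdl x"
    proof
      fix m assume m: "m \<in> M"
      have "m = m \<oplus> \<zero>" "\<zero> \<in> PIdl x"
        using m M.Icarr PI by (auto simp: ideal_def additive_subgroup.zero_closed)
      then show "m \<in> M <+>\<^bsub>R\<^esub> PIdl x"
        using m unfolding set_add_def' by blast
    qed
    moreover have "x \<in> M <+>\<^bsub>R\<^esub> PIdl x"
    proof -
      have "x = \<zero> \<oplus> x" using xc by simp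
      then show ?thesis
        using cgenideal_self[OF xc] M.zero_closed unfolding set_add_def' by blast
    qed
    ultimately have "M <+>\<^bsub>R\<^esub> PIdl x = carrier R"
      using M.I_maximal[of "M <+>\<^bsub>R\<^esub> PIdl x"] \<open>x \<notin> M\<close>
      by (metis ideal.Icarr subsetI)
    then have "\<one> \<in> M <+>\<^bsub>R\<^esub> PIdl x" by simp
    then obtain m r where m: "m \<in> M" and r: "r \<in> carrier R" and e: "m \<oplus> r \<otimes> x = \<one>"
      unfolding set_add_def' cgenideal_def by (auto dest: sym)
    have mc: "m \<in> carrier R" using m M.Icarr by blast
    have "r \<otimes> x = (m \<oplus> r \<otimes> x) \<ominus> m"
      using mc r xc by algebra
    then have rx: "r \<otimes> x = \<one> \<ominus> m"
      unfolding e .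
    have "x \<otimes> (r \<otimes> (\<one> \<oplus> m \<oplus> m \<otimes> m)) = (r \<otimes> x) \<otimes> (\<one> \<oplus> m \<oplus> m \<otimes> m)"
      using mc r xc by algebra
    also have "\<dots> = \<one> \<ominus> m \<otimes> m \<otimes> m"
      unfolding rx using mc by algebra
    also have "\<dots> = \<one>"
      unfolding zero[OF m m m] by algebra
    finally have "x \<in> Units R"
      using unit_if_mult_eq_one[OF xc, of "r \<otimes> (\<one> \<oplus> m \<oplus> m \<otimes> m)"] r mc by simp
    then show False using x by simp
  qed
  show ?thesis
    unfolding every_proper_ideal_w1ap_def weakly_1_absorbing_prime_def
    using zero inM by blast
qed

section \<open>Splitting a ring along an idempotent\<close>

lemma corner_ring_cring:
  assumes e: "e \<in> carrier R" "e \<otimes> e = e"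
  shows "cring (corner_ring R e)"
proof (rule cringI)
  show "abelian_group (corner_ring R e)"
  proof (rule abelian_groupI)
    fix x assume "x \<in> carrier (corner_ring R e)"
    then have "\<ominus> x \<in> carrier (corner_ring R e)" "\<ominus> x \<oplus> x = \<zero>"
      using e by (auto simp: corner_ring_def r_minus l_neg)
    then show "\<exists>y\<in>carrier (corner_ring R e). y \<oplus>\<^bsub>corner_ring R e\<^esub> x = \<zero>\<^bsub>corner_ring R e\<^esub>"
      by (auto simp: corner_ring_def)
  qed (use e in \<open>auto simp: corner_ring_def r_distr a_ac\<close>)
  show "comm_monoid (corner_ring R e)"
  proof (rule comm_monoidI)
    show "x \<otimes>\<^bsub>corner_ring R e\<^esub> y \<in> carrier (corner_ring R e)"
      if "x \<in> carrier (corner_ring R e)" "y \<in> carrier (corner_ring R e)" for x y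
      using that e(1) m_assoc[of e x y] by (auto simp: corner_ring_def)
    show "x \<otimes>\<^bsub>corner_ring R e\<^esub> y = y \<otimes>\<^bsub>corner_ring R e\<^esub> x"
      if "x \<in> carrier (corner_ring R e)" "y \<in> carrier (corner_ring R e)" for x y
      using that m_comm by (auto simp: corner_ring_def)
  qed (use e in \<open>auto simp: corner_ring_def m_assoc\<close>)
qed (use e in \<open>auto simp: corner_ring_def l_distr\<close>)

text \<open>The Peirce decomposition: \<open>e\<close> and \<open>1 - e\<close> are orthogonal
  idempotents with sum 1, so \<open>x\<close> is recovered by adding its two components.\<close>

lemma iso_corner_rings:
  assumes e: "e \<in> carrier R" "e \<otimes> e = e"
  shows "R \<simeq> RDirProd (corner_ring R e) (corner_ring R (\<one> \<ominus> e))"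
proof -
  let ?f = "\<one> \<ominus> e"
  have f: "?f \<in> carrier R" "?f \<otimes> ?f = ?f" "e \<otimes> ?f = \<zero>" "?f \<otimes> e = \<zero>" "e \<oplus> ?f = \<one>"
    using e by algebra+
  have in_e: "e \<otimes> (e \<otimes> x) = e \<otimes> x" and in_f: "?f \<otimes> (?f \<otimes> x) = ?f \<otimes> x" 
    and ef: "e \<otimes> (?f \<otimes> x) = \<zero>" and fe: "?f \<otimes> (e \<otimes> x) = \<zero>" 
    and split: "x = e \<otimes> x \<oplus> ?f \<otimes> x" if "x \<in> carrier R" for x
    using e f that by (simp_all flip: m_assoc l_distr)
  have "(\<lambda>x. (e \<otimes> x, ?f \<otimes> x)) \<in> ring_iso R (RDirProd (corner_ring R e) (corner_ring R ?f))"
  proof (rule ring_iso_memI)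
    show "bij_betw (\<lambda>x. (e \<otimes> x, ?f \<otimes> x)) (carrier R)
            (carrier (RDirProd (corner_ring R e) (corner_ring R ?f)))"
    proof (rule bij_betw_byWitness[where f' = "\<lambda>(x, y). x \<oplus> y"])
      show "\<forall>x\<in>carrier R. (\<lambda>(x, y). x \<oplus> y) (e \<otimes> x, ?f \<otimes> x) = x"
        using split by simp
      have "e \<otimes> (x \<oplus> y) = x \<and> ?f \<otimes> (x \<oplus> y) = y"
        if "x \<in> carrier R" "e \<otimes> x = x" "y \<in> carrier R" "?f \<otimes> y = y" for x y
        using that ef[OF that(3)] fe[OF that(1)] e(1) f(1) by (simp add: r_distr)
      then show "\<forall>p\<in>carrier (RDirProd (corner_ring R e) (corner_ring R ?f)).
         (e \<otimes> (\<lambda>(x, y). x \<oplus> y) p, ?f \<otimes> (\<lambda>(x, y). x \<oplus> y) p) = p"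
        by (auto simp: RDirProd_carrier corner_ring_def)
    qed (use e f in_e in_f in \<open>auto simp: RDirProd_carrier corner_ring_def\<close>)
    have mult: "g \<otimes> (x \<otimes> y) = g \<otimes> x \<otimes> (g \<otimes> y)"
      if "g \<in> carrier R" "g \<otimes> g = g" "x \<in> carrier R" "y \<in> carrier R" for g x y
    proof -
      have "g \<otimes> x \<otimes> (g \<otimes> y) = (g \<otimes> g) \<otimes> (x \<otimes> y)"
        using that(1,3,4) by algebra
      then show ?thesis using that(2) by simp
    qed
    show "(e \<otimes> (x \<otimes> y), ?f \<otimes> (x \<otimes> y)) = (e \<otimes> x, ?f \<otimes> x)
        \<otimes>\<^bsub>RDirProd (corner_ring R e) (corner_ring R ?f)\<^esub> (e \<otimes> y, ?f \<otimes> y)"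
      if "x \<in> carrier R" "y \<in> carrier R" for x y
      using mult[OF e that] mult[OF f(1,2) that]
      by (simp add: RDirProd_def DirProd_def monoid.defs corner_ring_def)
  qed (use e f in_e in_f in \<open>auto simp: RDirProd_def DirProd_def monoid.defs corner_ring_def r_distr\<close>)
  then show ?thesis
    by (auto simp: is_ring_iso_def)
qed

lemma compl_nonunit_idempotent:
  assumes w: "every_proper_ideal_w1ap R"
    and x: "x \<in> carrier R - Units R" and y: "\<one> \<ominus> x \<in> carrier R - Units R"
  shows "x \<otimes> x = x"
proof -
  \<comment> \<open>Stated for any two nonunits with sum 1, to be used for x and
    \<open>1 - x\<close> in both orders.\<close>
  have sq: "x \<otimes> x \<otimes> y = \<zero>"
    if x: "x \<in> carrier R - Units R" and y: "y \<in> carrier R - Units R" and s: "x \<oplus> y = \<one>" for x y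
  proof (rule ccontr)
    assume nz: "x \<otimes> x \<otimes> y \<noteq> \<zero>"
    have c: "x \<in> carrier R" "y \<in> carrier R" using x y by auto
    have "x = (x \<oplus> y) \<ominus> y" using c by algebra
    then have "x = \<one> \<ominus> y" unfolding s .
    from w1ap_nonunits_dichotomy[OF w x x y nz] show False
    proof (elim disjE bexE)
      fix r assume r: "r \<in> carrier R" "x \<otimes> x = r \<otimes> (x \<otimes> x \<otimes> y)"
      \<comment> \<open>As \<open>1 - x^2 = y(1 + x)\<close>, a y dividing x^2 also divides
        1.\<close>
      have "\<one> = x \<otimes> x \<oplus> y \<otimes> (\<one> \<oplus> x)"
        unfolding \<open>x = \<one> \<ominus> y\<close> using c by algebra
      also have "\<dots> = y \<otimes> (r \<otimes> (x \<otimes> x) \<oplus> (\<one> \<oplus> x))"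
        by (subst r(2)) (use c r(1) in algebra)
      finally have "y \<in> Units R"
        using unit_if_mult_eq_one[of y "r \<otimes> (x \<otimes> x) \<oplus> (\<one> \<oplus> x)"] c r(1) by simp
      then show False using y by simp
    next
      fix r assume r: "r \<in> carrier R" "y = r \<otimes> (x \<otimes> x \<otimes> y)"
      \<comment> \<open>Here x divides y, hence also \<open>x + y = 1\<close>.\<close>
      have "\<one> = x \<oplus> r \<otimes> (x \<otimes> x \<otimes> y)"
        using s r(2) by simp
      also have "\<dots> = x \<otimes> (\<one> \<oplus> r \<otimes> (x \<otimes> y))"
        using c r(1) by algebra
      finally have "x \<in> Units R"
        using unit_if_mult_eq_one[of x "\<one> \<oplus> r \<otimes> (x \<otimes> y)"] c r(1) by simp
      then show False using x by simp
    qed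
  qed
  let ?y = "\<one> \<ominus> x"
  have c: "x \<in> carrier R" using x by simp
  have "x \<oplus> ?y = \<one>" "?y \<oplus> x = \<one>" using c by algebra+
  then have "x \<otimes> x \<otimes> ?y = \<zero>" "?y \<otimes> ?y \<otimes> x = \<zero>"
    using sq[OF x y] sq[OF y x] by auto
  \<comment> \<open>With \<open>y = 1 - x\<close> the bracket is \<open>xy(x + y) = xy\<close>, and
    \<open>xx + xy = x\<close>.\<close>
  moreover have "x = x \<otimes> x \<oplus> (x \<otimes> x \<otimes> ?y \<oplus> ?y \<otimes> ?y \<otimes> x)"
    using c by algebra
  ultimately show ?thesis using c by simp
qed

text \<open>The witnesses in the dichotomy are \<open>e, e, m + (1 - e)\<close>, whose product is \<open>m\<close>.\<close>
lemma corner_ring_field: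
  assumes w: "every_proper_ideal_w1ap R"
    and e: "e \<in> carrier R - Units R" "e \<otimes> e = e" "e \<noteq> \<zero>"
  shows "field (corner_ring R e)"
proof -
  let ?f = "\<one> \<ominus> e"
  have c: "e \<in> carrier R" using e by simp
  interpret C: cring "corner_ring R e"
    using corner_ring_cring[OF c e(2)] .
  have "\<exists>n\<in>carrier R. e \<otimes> n = n \<and> m \<otimes> n = e"
    if m: "m \<in> carrier R" "e \<otimes> m = m" and nz: "m \<noteq> \<zero>" for m
  proof -
    have ef: "e \<otimes> ?f = \<zero>" "?f \<in> carrier R" using c e(2) by algebra+
    \<comment> \<open>Any r in R with \<open>e = rm\<close> is enough: \<open>er\<close> lies in the
      corner and inverts m there.\<close>
    have inverse: ?thesis if "r \<in> carrier R" "e = r \<otimes> m" for r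
    proof (intro bexI conjI)
      show "e \<otimes> (e \<otimes> r) = e \<otimes> r" using c that(1) e(2) by (simp flip: m_assoc)
      have "m \<otimes> (e \<otimes> r) = (e \<otimes> m) \<otimes> r" using c that(1) m(1) by algebra
      then show "m \<otimes> (e \<otimes> r) = e" using m that m_comm by simp
      show "e \<otimes> r \<in> carrier R" using c that(1) by simp
    qed
    let ?c = "m \<oplus> ?f"
    have cc: "?c \<in> carrier R" using m ef by simp
    have ec: "e \<otimes> ?c = m"
      using m ef c by (simp add: r_distr)
    show ?thesis
    \<comment> \<open>The dichotomy speaks of nonunits only. If \<open>?c\<close> is a unit,
      \<open>m = e ?c\<close> is inverted directly by \<open>e inv ?c\<close>.\<close>
    proof (cases "?c \<in> Units R")
      case True
      have "(e \<otimes> inv ?c) \<otimes> m = e \<otimes> (inv ?c \<otimes> (e \<otimes> ?c))"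
        using True c m cc by (simp add: ec m_assoc)
      also have "\<dots> = (e \<otimes> e) \<otimes> (inv ?c \<otimes> ?c)"
        using True c cc Units_inv_closed[OF True] by (simp only: m_ac m_closed)
      also have "\<dots> = e"
        using True c e(2) by simp
      finally show ?thesis
        using inverse[of "e \<otimes> inv ?c"] True c by simp
    next
      case False
      have p: "e \<otimes> e \<otimes> ?c = m" using e(2) ec by simp
      have "(\<exists>r\<in>carrier R. e \<otimes> e = r \<otimes> m) \<or> (\<exists>r\<in>carrier R. ?c = r \<otimes> m)"
        using w1ap_nonunits_dichotomy[OF w e(1) e(1), of ?c] False cc nz unfolding p by blast
      then show ?thesis
      proof (elim disjE bexE)
        fix r assume "r \<in> carrier R" "e \<otimes> e = r \<otimes> m"
        then show ?thesis using inverse e(2) by simp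
      next
        fix r assume r: "r \<in> carrier R" "?c = r \<otimes> m"
        \<comment> \<open>Multiplying \<open>?c = rm\<close> by \<open>1 - e\<close> gives
          \<open>1 - e\<close> on the left and 0 on the right, so e would be the unit 1.\<close>
        have fm: "?f \<otimes> m = \<zero>"
        proof -
          have "?f \<otimes> m = m \<ominus> e \<otimes> m" using c m(1) by algebra
          then show ?thesis using m by (simp add: minus_eq r_neg)
        qed
        have "?f \<otimes> ?c = r \<otimes> (?f \<otimes> m)"
          unfolding r(2) using r(1) m(1) ef(2) by (simp add: m_lcomm)
        moreover have "?f \<otimes> ?c = ?f"
        proof -
          have "?f \<otimes> ?f = ?f" using c e(2) by algebra
          then show ?thesis using m ef(2) fm by (simp add: r_distr)
        qed
        ultimately have "?f = \<zero>" using fm r(1) by simp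
        moreover have "e = \<one> \<ominus> ?f" using c by algebra
        ultimately have "e = \<one>" by (simp add: minus_eq)
        then show ?thesis using e(1) by simp
      qed
    qed
  qed
  then show ?thesis
    using e by (intro C.cring_fieldI2) (auto simp: corner_ring_def)
qed

end

text \<open>A field is local with maximal ideal 0, whose square is 0; two fields thus form a special
  case of (3).\<close>

lemma local_square_zero_times_fieldI:
  fixes R1 R2 :: "'a ring" and R :: "('a, 'b) ring_scheme"
  assumes "field R1" "field R2" "R \<simeq> RDirProd R1 R2"
  shows "local_square_zero_times_field R"
proof -
  interpret R1: field R1 by fact
  have "N = {\<zero>\<^bsub>R1\<^esub>}" if "maximalideal N R1" for N
  proof -
    interpret N: maximalideal N R1 by fact
    have "N \<in> {I. ideal I R1}"
      using N.ideal_axioms by blast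
    then show ?thesis using N.I_notcarr R1.all_ideals by blast
  qed
  then have "local_ring_with_max R1 {\<zero>\<^bsub>R1\<^esub>}"
    unfolding local_ring_with_max_def using R1.zeromaximalideal R1.is_cring by blast
  then show ?thesis
    using assms R1.ideal_prod_zero[OF R1.zeroideal]
    unfolding local_square_zero_times_field_def by blast
qed

lemma (in cring) w1ap_imp_local_or_product:
  assumes one: "\<one> \<noteq> \<zero>" and w: "every_proper_ideal_w1ap R"
  shows "local_cube_zero R \<or> local_square_zero_times_field R"
proof (cases "\<forall>x \<in> carrier R - Units R. \<one> \<ominus> x \<in> Units R")
  case True
  then show ?thesis using local_cube_zero_if_w1ap[OF one w] by blast
next
  case False
  then obtain x where x: "x \<in> carrier R - Units R" and "\<one> \<ominus> x \<notin> Units R" by blast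
  then have y: "\<one> \<ominus> x \<in> carrier R - Units R" by simp
  have c: "x \<in> carrier R" using x by simp
  have xx: "x \<otimes> x = x" using compl_nonunit_idempotent[OF w x y] .
  then have yy: "(\<one> \<ominus> x) \<otimes> (\<one> \<ominus> x) = \<one> \<ominus> x" using c by algebra
  \<comment> \<open>If one of x and \<open>1 - x\<close> were 0, the other would be the unit 1. Both
    idempotents are thus nonzero, as \<open>corner_ring_field\<close> requires.\<close>
  have "x \<noteq> \<zero>" using y by (auto simp: minus_eq)
  moreover have "\<one> \<ominus> x \<noteq> \<zero>"
  proof
    assume "\<one> \<ominus> x = \<zero>"
    moreover have "x = \<one> \<ominus> (\<one> \<ominus> x)" using c by algebra
    ultimately have "x = \<one>" by (simp add: minus_eq)
    then show False using x by simp
  qed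
  ultimately show ?thesis
    using local_square_zero_times_fieldI iso_corner_rings[OF c xx]
      corner_ring_field[OF w x xx] corner_ring_field[OF w y yy] by blast
qed

section \<open>Residue rings and the two counterexamples\<close>

lemma residue_ring_iso_prod:
  assumes "1 < m" "1 < n" "coprime m n"
  shows "residue_ring (m * n) \<simeq> RDirProd (residue_ring m) (residue_ring n)"
proof -
  let ?h = "\<lambda>x. (x mod m, x mod n)"
  have "?h \<in> ring_iso (residue_ring (m * n)) (RDirProd (residue_ring m) (residue_ring n))"
  proof (rule ring_iso_memI)
    have "inj_on ?h {0..m * n - 1}"
    proof (rule inj_onI)
      fix x y assume xy: "x \<in> {0..m * n - 1}" "y \<in> {0..m * n - 1}" "?h x = ?h y"
      then have "[x = y] (mod (m * n))"
        using coprime_cong_mult[of x y m n] assms(3) by (simp add: cong_def)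
      then show "x = y" using xy by (simp add: cong_def)
    qed
    moreover have "?h ` {0..m * n - 1} = {0..m - 1} \<times> {0..n - 1}"
    \<comment> \<open>Surjectivity by counting: the image of the injective map already has mn
      elements.\<close>
    proof (rule card_subset_eq)
      show "?h ` {0..m * n - 1} \<subseteq> {0..m - 1} \<times> {0..n - 1}"
        using assms by auto
      show "card (?h ` {0..m * n - 1}) = card ({0..m - 1} \<times> {0..n - 1})"
        using assms by (simp add: card_image[OF \<open>inj_on ?h _\<close>] card_cartesian_product nat_mult_distrib)
    qed simp
    ultimately show "bij_betw ?h (carrier (residue_ring (m * n)))
        (carrier (RDirProd (residue_ring m) (residue_ring n)))"
      by (simp add: bij_betw_def residue_ring_def RDirProd_carrier)
  qed (use assms in \<open>auto simp: residue_ring_def RDirProd_def DirProd_def monoid.defs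
        mod_mod_cancel mod_simps\<close>)
  then show ?thesis by (auto simp: is_ring_iso_def)
qed

lemma residue_ring_field:
  assumes "prime p"
  shows "field (residue_ring (int p))"
  using residues_prime.is_field[of p] assms by (simp add: residues_prime_def)

text \<open>\<open>3 * 3 * 2\<close> is a nonzero element of the ideal \<open>(6)\<close>, which contains neither \<open>9\<close> nor \<open>2\<close>.\<close>
lemma residue_ring_not_w1ap:
  assumes "6 dvd n" "\<not> n dvd 18" "10 < n"
  shows "\<not> every_proper_ideal_w1ap (residue_ring n)"
proof
  interpret residues n "residue_ring n"
    using assms by unfold_locales auto
  let ?R = "residue_ring n" and ?I = "PIdl\<^bsub>residue_ring n\<^esub> 6"
  \<comment> \<open>Since 6 divides n, reduction modulo n preserves divisibility by 6, so elements
    of the ideal are multiples of 6 as integers.\<close>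
  have I: "6 dvd x" if "x \<in> ?I" for x
    using that assms(1) by (auto simp: cgenideal_def res_mult_eq dvd_mod)
  have six: "6 \<in> carrier ?R" using assms by (simp add: res_carrier_eq)
  have "\<not> coprime 3 n" "\<not> coprime 2 n"
    using assms(1) by (auto simp: coprime_absorb_left dest: dvd_trans[rotated])
  then have nu: "3 \<in> carrier ?R - Units ?R" "2 \<in> carrier ?R - Units ?R"
    using assms by (auto simp: res_carrier_eq res_units_eq)
  assume "every_proper_ideal_w1ap ?R"
  moreover have "1 \<in> carrier ?R" "1 \<notin> ?I"
    using assms I[of 1] by (auto simp: res_carrier_eq)
  ultimately have w: "weakly_1_absorbing_prime ?I ?R"
    using cgenideal_ideal[OF six] unfolding every_proper_ideal_w1ap_def by blast
  \<comment> \<open>The bound on n keeps 9 from being reduced.\<close>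
  have "3 \<otimes>\<^bsub>?R\<^esub> 3 = 9" using assms by (simp add: res_mult_eq)
  moreover have "9 \<otimes>\<^bsub>?R\<^esub> 2 \<in> ?I"
  proof -
    have "9 \<otimes>\<^bsub>?R\<^esub> 2 = 3 \<otimes>\<^bsub>?R\<^esub> 6" by (simp add: res_mult_eq)
    moreover have "3 \<in> carrier ?R" using nu by simp
    ultimately show ?thesis unfolding cgenideal_def by blast
  qed
  \<comment> \<open>The product 18 may be reduced, to 6 for \<open>n = 12\<close>; it is nonzero
    because n does not divide 18.\<close>
  moreover have "9 \<otimes>\<^bsub>?R\<^esub> 2 \<noteq> \<zero>\<^bsub>?R\<^esub>"
    using assms(2) by (simp add: res_mult_eq res_zero_eq mod_eq_0_iff_dvd)
  moreover have "9 \<notin> ?I" "2 \<notin> ?I" using I[of 9] I[of 2] by auto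
  ultimately show False
    using w nu unfolding weakly_1_absorbing_prime_def by metis
qed

text \<open>The nonunits modulo 4 are 0 and 2. Their complements 1 and \<open>1 - 2 = 3\<close> are
  units, and \<open>2 * 2 = 0\<close>.\<close>

lemma residue_ring_4_local:
  "\<exists>M. local_ring_with_max (residue_ring 4) M \<and>
     ideal_prod (residue_ring 4) M M = {\<zero>\<^bsub>residue_ring 4\<^esub>}"
proof -
  let ?R = "residue_ring 4"
  interpret residues 4 ?R
    by unfold_locales auto
  have carr: "carrier ?R = {0, 1, 2, 3}"
    by (auto simp: res_carrier_eq)
  have "coprime (3::int) 4" by code_simp
  then have nonunits: "carrier ?R - Units ?R = {0, 2}"
    unfolding carr by (auto simp: res_units_eq)
  have "\<one>\<^bsub>?R\<^esub> \<ominus>\<^bsub>?R\<^esub> x \<in> Units ?R" if "x \<in> {0, 2}" for x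
    using that \<open>coprime (3::int) 4\<close>
    by (auto simp: res_units_eq a_minus_def res_neg_eq res_add_eq res_one_eq)
  then have loc: "local_ring_with_max ?R {0, 2}"
    using local_ring_with_max_nonunits unfolding nonunits
    by (simp add: res_one_eq res_zero_eq)
  moreover have "ideal_prod ?R {0, 2} {0, 2} = {\<zero>\<^bsub>?R\<^esub>}"
    using loc by (intro ideal_prod_eq_zero)
      (auto simp: local_ring_with_max_def maximalideal_def res_mult_eq res_zero_eq)
  ultimately show ?thesis by blast
qed

theorem theorem3p6:
  fixes R :: "('a, 'b) ring_scheme"
  assumes "cring R" and "\<one>\<^bsub>R\<^esub> \<noteq> \<zero>\<^bsub>R\<^esub>"
  shows "(every_proper_ideal_w1ap R \<longrightarrow>
            local_cube_zero R \<or> local_square_zero_times_field R \<or> product_of_three_fields R)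
       \<and> (local_cube_zero R \<longrightarrow> every_proper_ideal_w1ap R)
       \<and> (\<exists>S :: int ring. cring S \<and> \<one>\<^bsub>S\<^esub> \<noteq> \<zero>\<^bsub>S\<^esub> \<and>
            local_square_zero_times_field S \<and> \<not> every_proper_ideal_w1ap S)
       \<and> (\<exists>S :: int ring. cring S \<and> \<one>\<^bsub>S\<^esub> \<noteq> \<zero>\<^bsub>S\<^esub> \<and>
            product_of_three_fields S \<and> \<not> every_proper_ideal_w1ap S)"
proof (intro conjI impI)
  interpret cring R by fact
  show "local_cube_zero R \<or> local_square_zero_times_field R \<or> product_of_three_fields R"
    if "every_proper_ideal_w1ap R"
    using w1ap_imp_local_or_product[OF assms(2) that] by blast
  show "every_proper_ideal_w1ap R" if "local_cube_zero R"
    using w1ap_if_local_cube_zero[OF that] .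
  have ring: "cring (residue_ring n)" "\<one>\<^bsub>residue_ring n\<^esub> \<noteq> \<zero>\<^bsub>residue_ring n\<^esub>" if "1 < n" for n
    using residues.cring[of n] that by (simp_all add: residues_def residue_ring_def)
  have fields: "field (residue_ring 2)" "field (residue_ring 3)" "field (residue_ring 5)"
    using residue_ring_field[of 2] residue_ring_field[of 3] residue_ring_field[of 5] by simp_all
  show "\<exists>S :: int ring. cring S \<and> \<one>\<^bsub>S\<^esub> \<noteq> \<zero>\<^bsub>S\<^esub> \<and>
            local_square_zero_times_field S \<and> \<not> every_proper_ideal_w1ap S"
  proof (intro exI conjI)
    \<comment> \<open>The modulus 12 is a multiple of 6 that does not divide 18, and its coprime
      factors 4 and 3 give the local ring and the field.\<close>
    have "residue_ring 12 \<simeq> RDirProd (residue_ring 4) (residue_ring 3)"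
    proof -
      have "coprime (4::int) 3" by code_simp
      then show ?thesis using residue_ring_iso_prod[of 4 3] by simp
    qed
    then show "local_square_zero_times_field (residue_ring 12)"
      unfolding local_square_zero_times_field_def
      using residue_ring_4_local fields(2) by blast
  qed (use ring[of 12] residue_ring_not_w1ap[of 12] in auto)
  show "\<exists>S :: int ring. cring S \<and> \<one>\<^bsub>S\<^esub> \<noteq> \<zero>\<^bsub>S\<^esub> \<and>
            product_of_three_fields S \<and> \<not> every_proper_ideal_w1ap S"
  proof (intro exI conjI)
    \<comment> \<open>Two coprime splittings, \<open>30 = 2 * 15\<close> and
      \<open>15 = 3 * 5\<close>; the second is carried out inside the second factor of the
      first.\<close>
    have "residue_ring 30 \<simeq> RDirProd (residue_ring 2) (residue_ring 15)"
      using residue_ring_iso_prod[of 2 15] by simp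
    moreover have "residue_ring 15 \<simeq> RDirProd (residue_ring 3) (residue_ring 5)"
    proof -
      have "coprime (3::int) 5" by code_simp
      then show ?thesis using residue_ring_iso_prod[of 3 5] by simp
    qed
    ultimately have "residue_ring 30 \<simeq>
        RDirProd (residue_ring 2) (RDirProd (residue_ring 3) (residue_ring 5))"
      using ring_iso_set_trans RDirProd_iso5 unfolding is_ring_iso_def by blast
    then show "product_of_three_fields (residue_ring 30)"
      unfolding product_of_three_fields_def using fields by blast
  qed (use ring[of 30] residue_ring_not_w1ap[of 30] in auto)
qed

end
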